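(* Let $\mathcal{H}$ be a Hilbert space and consider the map $\alpha:\mathcal{J}_{\mathfrak{X}}\to L(\mathcal{H})$, $\alpha(V)=V^2$. Then $\alpha$ is a bijection from $\mathcal{J}_{\mathfrak{X}}$ onto $\mathfrak{X}$. In particular, $\mathfrak{X}=\{V^2:V\in\mathcal{J}_{\mathfrak{X}}\}$.
   Context: $L(\mathcal{H})$ is the algebra of bounded linear operators on $\mathcal{H}$; $N(\cdot)$ denotes nullspace. $\mathfrak{X}$ is the set of all products $PQ$ of two orthogonal projections $P,Q\in L(\mathcal{H})$. The polar decomposition of $C\in L(\mathcal{H})$ is the unique factorization $C=V_C|C|$ with $|C|=(C^*C)^{1/2}$ and $V_C$ a partial isometry with $N(V_C)=N(C)$; $V_C$ is the isometric part of $C$. $\mathcal{J}_{\mathfrak{X}}=\{V_T:T\in\mathfrak{X}\}$. *)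

theory Defs
  imports "HOL-Analysis.Analysis"
begin

text \<open>
  The class of complex Hilbert spaces, built on the real Banach spaces of the library. The inner
  product is linear in its first argument. Positivity and definiteness of the inner product are
  consequences of \<open>cinner_self\<close> together with the axioms for the norm.
\<close>

class complex_hilbert = banach +
  fixes scaleC :: "complex \<Rightarrow> 'a \<Rightarrow> 'a"  (infixr \<open>*\<^sub>C\<close> 75)
    and cinner :: "'a \<Rightarrow> 'a \<Rightarrow> complex"
  assumes scaleC_add_right: "c *\<^sub>C (x + y) = c *\<^sub>C x + c *\<^sub>C y"
    and scaleC_add_left: "(c + d) *\<^sub>C x = c *\<^sub>C x + d *\<^sub>C x"
    and scaleC_scaleC: "c *\<^sub>C (d *\<^sub>C x) = (c * d) *\<^sub>C x"
    and scaleC_of_real: "complex_of_real r *\<^sub>C x = r *\<^sub>R x"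
    and cinner_commute: "cinner x y = cnj (cinner y x)"
    and cinner_add_left: "cinner (x + y) z = cinner x z + cinner y z"
    and cinner_scaleC_left: "cinner (c *\<^sub>C x) y = c * cinner x y"
    and cinner_self: "cinner x x = complex_of_real ((norm x)\<^sup>2)"

definition bounded_clinear :: "('a::complex_hilbert \<Rightarrow> 'a) \<Rightarrow> bool" where
  "bounded_clinear A \<longleftrightarrow> bounded_linear A \<and> (\<forall>c x. A (c *\<^sub>C x) = c *\<^sub>C A x)"

definition nullspace :: "('a::complex_hilbert \<Rightarrow> 'a) \<Rightarrow> 'a set" where
  "nullspace A = {x. A x = 0}"

definition cadjoint :: "('a::complex_hilbert \<Rightarrow> 'a) \<Rightarrow> ('a \<Rightarrow> 'a)" where
  "cadjoint A = (THE B. bounded_clinear B \<and> (\<forall>x y. cinner (A x) y = cinner x (B y)))"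

text \<open>Over the complex numbers, self-adjointness is implied by this condition.\<close>

definition positive_op :: "('a::complex_hilbert \<Rightarrow> 'a) \<Rightarrow> bool" where
  "positive_op A \<longleftrightarrow> bounded_clinear A \<and> (\<forall>x. cinner (A x) x \<in> \<real>\<^sub>\<ge>\<^sub>0)"

definition sqrt_op :: "('a::complex_hilbert \<Rightarrow> 'a) \<Rightarrow> ('a \<Rightarrow> 'a)" where
  "sqrt_op A = (THE B. positive_op B \<and> B ^^ 2 = A)"

definition abs_op :: "('a::complex_hilbert \<Rightarrow> 'a) \<Rightarrow> ('a \<Rightarrow> 'a)" where
  "abs_op C = sqrt_op (cadjoint C \<circ> C)"

definition orthogonal_projection :: "('a::complex_hilbert \<Rightarrow> 'a) \<Rightarrow> bool" where
  "orthogonal_projection P \<longleftrightarrow> bounded_clinear P \<and> P ^^ 2 = P \<and> cadjoint P = P"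

definition partial_isometry :: "('a::complex_hilbert \<Rightarrow> 'a) \<Rightarrow> bool" where
  "partial_isometry V \<longleftrightarrow> bounded_clinear V \<and>
     (\<forall>x. (\<forall>z\<in>nullspace V. cinner x z = 0) \<longrightarrow> norm (V x) = norm x)"

definition isometric_part :: "('a::complex_hilbert \<Rightarrow> 'a) \<Rightarrow> ('a \<Rightarrow> 'a)" where
  "isometric_part C =
     (THE V. partial_isometry V \<and> nullspace V = nullspace C \<and> C = V \<circ> abs_op C)"

definition projection_products :: "('a::complex_hilbert \<Rightarrow> 'a) set"  (\<open>\<XX>\<close>) where
  "\<XX> = {P \<circ> Q | P Q. orthogonal_projection P \<and> orthogonal_projection Q}"

definition isometric_parts :: "('a::complex_hilbert \<Rightarrow> 'a) set"  (\<open>\<J>\<^sub>\<XX>\<close>) where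
  "\<J>\<^sub>\<XX> = {isometric_part T | T. T \<in> \<XX>}"

end

theory Submission
  imports Defs
begin

text \<open>
  The inverse of \<open>\<alpha>\<close> is \<open>T \<mapsto> V\<^sub>T\<close>, that is, \<open>V\<^sub>T\<^sup>2 = T\<close> for \<open>T = PQ\<close>.
  Such a \<open>T\<close> satisfies \<open>T T\<^sup>* T = PQPQ = T\<^sup>2\<close>. Write \<open>S = |T|\<close> and \<open>T = V S\<close>, so that
  \<open>N(S) = N(T) = N(V)\<close>. From \<open>T (T - S\<^sup>2) = 0\<close> we get \<open>S (V S - S\<^sup>2) = 0\<close>, so \<open>S V\<close> and \<open>S\<^sup>2\<close>
  agree on the closure of \<open>R(S)\<close>; both vanish on its complement \<open>N(S)\<close>. Hence \<open>V - S\<close> maps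
  into \<open>N(S) = N(V)\<close>, and \<open>V\<^sup>2 = V S = T\<close>.
\<close>

section \<open>Inner product\<close>

lemma cinner_add_right: "cinner x (y + z) = cinner x y + cinner x z"
  for x :: "'a::complex_hilbert"
  by (metis cinner_add_left cinner_commute complex_cnj_add)

lemma cinner_scaleC_right: "cinner x (c *\<^sub>C y) = cnj c * cinner x y"
  for x :: "'a::complex_hilbert"
  by (metis cinner_scaleC_left cinner_commute complex_cnj_mult)

lemma cinner_scaleR_left: "cinner (r *\<^sub>R x) y = r *\<^sub>R cinner x y"
  for x :: "'a::complex_hilbert"
  by (metis cinner_scaleC_left scaleC_of_real scaleR_conv_of_real)

lemma cinner_scaleR_right: "cinner x (r *\<^sub>R y) = r *\<^sub>R cinner x y"
  for x :: "'a::complex_hilbert"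
  by (metis cinner_scaleC_right scaleC_of_real scaleR_conv_of_real complex_cnj_complex_of_real)

lemma norm_add_sq: "(norm (x + y))\<^sup>2 = (norm x)\<^sup>2 + (norm y)\<^sup>2 + 2 * Re (cinner x y)"
  for x :: "'a::complex_hilbert"
proof -
  have "cinner (x + y) (x + y) = cinner x x + cinner y y + (cinner x y + cnj (cinner x y))"
    by (simp add: cinner_add_left cinner_add_right flip: cinner_commute)
  then have "Re (cinner (x + y) (x + y)) = Re (cinner x x) + Re (cinner y y) + 2 * Re (cinner x y)"
    by simp
  then show ?thesis by (simp only: cinner_self Re_complex_of_real)
qed

lemma norm_scaleC: "norm (c *\<^sub>C x) = cmod c * norm x"
  for x :: "'a::complex_hilbert"
proof -
  have "cinner (c *\<^sub>C x) (c *\<^sub>C x) = (c * cnj c) * cinner x x"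
    by (simp add: cinner_scaleC_left cinner_scaleC_right)
  then have "complex_of_real ((norm (c *\<^sub>C x))\<^sup>2) = complex_of_real ((cmod c * norm x)\<^sup>2)"
    by (simp only: cinner_self complex_norm_square[symmetric] power_mult_distrib of_real_mult of_real_power)
  then have "(norm (c *\<^sub>C x))\<^sup>2 = (cmod c * norm x)\<^sup>2"
    by (simp only: of_real_eq_iff)
  then show ?thesis by (simp add: power2_eq_iff_nonneg)
qed

text \<open>The perturbation of \<open>z\<close> along \<open>m\<close> carries the factor
  \<open>cinner z m\<close> so that the cross term becomes real. What remains is a quadratic in the
  real parameter \<open>t\<close>, which serves both the orthogonality criterion and the
  Cauchy-Schwarz inequality.\<close>

lemma norm_add_scaled_cinner_sq:
  fixes z m :: "'a::complex_hilbert"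
  shows "(norm (z + ((- of_real t) * cinner z m) *\<^sub>C m))\<^sup>2
    = (norm z)\<^sup>2 + (cmod (cinner z m))\<^sup>2 * (t\<^sup>2 * (norm m)\<^sup>2 - 2 * t)"
proof -
  have "cinner z (((- of_real t) * cinner z m) *\<^sub>C m) = - of_real t * (cinner z m * cnj (cinner z m))"
    by (simp add: cinner_scaleC_right)
  also have "\<dots> = of_real (- t * (cmod (cinner z m))\<^sup>2)"
    by (simp flip: complex_norm_square)
  finally have "Re (cinner z (((- of_real t) * cinner z m) *\<^sub>C m)) = - t * (cmod (cinner z m))\<^sup>2"
    by (simp only: Re_complex_of_real)
  then show ?thesis
    unfolding norm_add_sq
    by (simp add: norm_scaleC norm_mult power_mult_distrib algebra_simps)
qed

text \<open>If \<open>cinner z m\<close> were nonzero, moving \<open>z\<close> along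
  \<open>m\<close> by the optimal multiple would strictly shorten it.\<close>

lemma cinner_eq_0_if_minimal:
  fixes z m :: "'a::complex_hilbert"
  assumes "\<And>c. norm z \<le> norm (z + c *\<^sub>C m)"
  shows "cinner z m = 0"
proof (cases "m = 0")
  case True
  have "cinner z 0 = 0" using cinner_scaleR_right[of z 0 0] by simp
  then show ?thesis using True by simp
next
  case False
  \<comment> \<open>The vertex of the parabola t^2 |m|^2 - 2t, where its value is -t.\<close>
  define t where "t = 1 / (norm m)\<^sup>2"
  have "(norm z)\<^sup>2 \<le> (norm z)\<^sup>2 + (cmod (cinner z m))\<^sup>2 * (t\<^sup>2 * (norm m)\<^sup>2 - 2 * t)"
    using assms[of "(- of_real t) * cinner z m"]
    unfolding norm_add_scaled_cinner_sq[symmetric] by (simp add: power_mono)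
  moreover have "t\<^sup>2 * (norm m)\<^sup>2 - 2 * t = - t"
    using False by (simp add: t_def power2_eq_square)
  ultimately have "(cmod (cinner z m))\<^sup>2 * t \<le> 0" by simp
  moreover have "t > 0" using False by (simp add: t_def)
  ultimately have "(cmod (cinner z m))\<^sup>2 \<le> 0" by (simp add: mult_le_0_iff)
  then show ?thesis by simp
qed

text \<open>The squared norm of \<open>x\<close> minus its component along \<open>y\<close> is
  nonnegative; at the vertex \<open>t\<close> of the quadratic this is the claimed bound.\<close>

lemma Cauchy_Schwarz_cinner: "cmod (cinner x y) \<le> norm x * norm y"
  for x :: "'a::complex_hilbert"
proof (cases "y = 0")
  case True
  have "cinner x 0 = 0" using cinner_scaleR_right[of x 0 0] by simp
  then show ?thesis using True by simp
next
  case False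
  define t where "t = 1 / (norm y)\<^sup>2"
  have "0 \<le> (norm x)\<^sup>2 + (cmod (cinner x y))\<^sup>2 * (t\<^sup>2 * (norm y)\<^sup>2 - 2 * t)"
    unfolding norm_add_scaled_cinner_sq[symmetric] by simp
  moreover have "t\<^sup>2 * (norm y)\<^sup>2 - 2 * t = - t"
    using False by (simp add: t_def power2_eq_square)
  ultimately have "(cmod (cinner x y))\<^sup>2 * t \<le> (norm x)\<^sup>2" by simp
  then have "(cmod (cinner x y))\<^sup>2 \<le> (norm x * norm y)\<^sup>2"
    using False by (simp add: t_def field_simps)
  then show ?thesis by (rule power2_le_imp_le) simp
qed

lemma bounded_bilinear_cinner: "bounded_bilinear (cinner :: 'a::complex_hilbert \<Rightarrow> 'a \<Rightarrow> complex)"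
proof
  show "\<exists>K. \<forall>a b :: 'a. norm (cinner a b) \<le> norm a * norm b * K"
    using Cauchy_Schwarz_cinner by (intro exI[of _ 1]) auto
qed (simp_all add: cinner_add_left cinner_add_right cinner_scaleR_left cinner_scaleR_right)

interpretation cinner: bounded_bilinear "cinner :: 'a::complex_hilbert \<Rightarrow> 'a \<Rightarrow> complex"
  by (rule bounded_bilinear_cinner)

lemma cinner_self_eq_0_iff [simp]: "cinner x x = 0 \<longleftrightarrow> x = 0"
  for x :: "'a::complex_hilbert"
  by (simp add: cinner_self)

lemma cinner_eq_0_sym: "cinner x y = 0 \<longleftrightarrow> cinner y x = 0"
  for x :: "'a::complex_hilbert"
  by (metis cinner_commute complex_cnj_zero)

lemma cinner_ext:
  fixes y z :: "'a::complex_hilbert"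
  assumes "\<And>x. cinner x y = cinner x z"
  shows "y = z"
proof -
  have "cinner (y - z) (y - z) = 0" using assms by (simp add: cinner.diff_right)
  then show ?thesis by simp
qed

lemma norm_eq_cmod_cinner: "(norm x)\<^sup>2 = cmod (cinner x x)"
  for x :: "'a::complex_hilbert"
  by (simp add: cinner_self norm_power)

lemma scaleC_simps [simp]:
  fixes x :: "'a::complex_hilbert"
  shows "0 *\<^sub>C x = 0" "1 *\<^sub>C x = x" "c *\<^sub>C (0::'a) = 0"
  using scaleC_of_real[of 0 x] scaleC_of_real[of 1 x] norm_scaleC[of c "0::'a"] by auto

lemma bounded_linear_scaleC: "bounded_linear (\<lambda>x::'a::complex_hilbert. c *\<^sub>C x)"
proof (rule bounded_linear_intro[where K = "cmod c"])
  fix r and x :: 'a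
  show "c *\<^sub>C r *\<^sub>R x = r *\<^sub>R c *\<^sub>C x"
    by (simp add: scaleC_scaleC mult.commute flip: scaleC_of_real)
qed (simp_all add: scaleC_add_right norm_scaleC mult.commute)

section \<open>Orthogonal complements and adjoints\<close>

definition csubspace :: "'a::complex_hilbert set \<Rightarrow> bool" where
  "csubspace M \<longleftrightarrow> 0 \<in> M \<and> (\<forall>x\<in>M. \<forall>y\<in>M. x + y \<in> M) \<and> (\<forall>c. \<forall>x\<in>M. c *\<^sub>C x \<in> M)"

lemma csubspace_scaleR: "csubspace M \<Longrightarrow> x \<in> M \<Longrightarrow> r *\<^sub>R x \<in> M"
  unfolding csubspace_def by (metis scaleC_of_real)

text \<open>Solved for the difference and stated with the midpoint: in a minimising sequence for the
  distance to a subspace, the midpoint term is bounded below by the squared infimum, so differences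
  become small.\<close>

lemma parallelogram: "(norm (a - b))\<^sup>2 = 2 * (norm a)\<^sup>2 + 2 * (norm b)\<^sup>2 - 4 * (norm ((1/2) *\<^sub>R (a + b)))\<^sup>2"
  for a :: "'a::complex_hilbert"
proof -
  have "(norm ((1/2) *\<^sub>R (a + b)))\<^sup>2 = (norm (a + b))\<^sup>2 / 4"
    by (simp only: norm_scaleR) (simp add: power_divide)
  then show ?thesis
    using norm_add_sq[of a b] norm_add_sq[of a "- b"] by (simp add: cinner.minus_right)
qed

text \<open>A sequence in \<open>M\<close> whose distances to \<open>x\<close> tend to the infimum
  is Cauchy by the parallelogram law. Its limit exists by completeness, lies in \<open>M\<close> by
  closedness, and attains the infimum.\<close>

lemma closest_point_csubspace:
  fixes M :: "'a::complex_hilbert set"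
  assumes "csubspace M" "closed M"
  obtains p where "p \<in> M" "\<And>m. m \<in> M \<Longrightarrow> norm (x - p) \<le> norm (x - m)"
proof -
  define D where "D = (\<lambda>m. norm (x - m)) ` M"
  define d where "d = Inf D"
  have ne: "D \<noteq> {}" using assms by (auto simp: D_def csubspace_def)
  have bd: "bdd_below D" by (auto simp: D_def intro: bdd_belowI[of _ 0])
  have le: "d \<le> norm (x - m)" if "m \<in> M" for m
    unfolding d_def using bd that by (auto simp: D_def intro: cInf_lower)
  have d0: "0 \<le> d" unfolding d_def using ne by (rule cInf_greatest) (auto simp: D_def)
  have "\<exists>m\<in>M. norm (x - m) < d + 1 / real (Suc n)" for n
  proof -
    have "Inf D < d + 1 / real (Suc n)" by (simp add: d_def)
    then show ?thesis using cInf_lessD[OF ne] by (auto simp: D_def)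
  qed
  then obtain m where m: "\<And>n. m n \<in> M" "\<And>n. norm (x - m n) < d + 1 / real (Suc n)" by metis
  have lim: "(\<lambda>n. norm (x - m n)) \<longlonglongrightarrow> d"
  proof (rule tendsto_sandwich[where f = "\<lambda>_. d" and h = "\<lambda>n. d + 1 / real (Suc n)"])
    show "(\<lambda>n. d + 1 / real (Suc n)) \<longlonglongrightarrow> d"
      using tendsto_add[OF tendsto_const LIMSEQ_inverse_real_of_nat, of d] by (simp add: inverse_eq_divide)
    show "\<forall>\<^sub>F n in sequentially. d \<le> norm (x - m n)" using le m(1) by simp
    show "\<forall>\<^sub>F n in sequentially. norm (x - m n) \<le> d + 1 / real (Suc n)"
      by (intro always_eventually allI less_imp_le m(2))
  qed (rule tendsto_const)
  have "Cauchy m"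
  proof (rule metric_CauchyI)
    fix e :: real assume e: "e > 0"
    have "(\<lambda>n. (norm (x - m n))\<^sup>2) \<longlonglongrightarrow> d\<^sup>2" by (intro tendsto_intros lim)
    \<comment> \<open>The margin e^2/4 is counted twice for each of the two points in the
      parallelogram law, for a total of e^2.\<close>
    then have "\<forall>\<^sub>F n in sequentially. (norm (x - m n))\<^sup>2 < d\<^sup>2 + e\<^sup>2 / 4"
      using e by (auto intro: order_tendstoD)
    then obtain N where N: "\<And>n. n \<ge> N \<Longrightarrow> (norm (x - m n))\<^sup>2 < d\<^sup>2 + e\<^sup>2 / 4"
      by (auto simp: eventually_sequentially)
    show "\<exists>M. \<forall>i\<ge>M. \<forall>j\<ge>M. dist (m i) (m j) < e"
    proof (intro exI allI impI)
      fix i j assume ij: "i \<ge> N" "j \<ge> N"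
      have mid: "(1/2) *\<^sub>R (m i + m j) \<in> M"
        using assms(1) m(1) by (auto intro!: csubspace_scaleR simp: csubspace_def)
      have "(1/2) *\<^sub>R ((x - m i) + (x - m j)) = x - (1/2) *\<^sub>R (m i + m j)"
        by (simp add: algebra_simps flip: scaleR_add_left)
      then have "d\<^sup>2 \<le> (norm ((1/2) *\<^sub>R ((x - m i) + (x - m j))))\<^sup>2"
        using le[OF mid] d0 by (simp add: power_mono)
      then have "(norm ((x - m i) - (x - m j)))\<^sup>2 < e\<^sup>2"
        using N[OF ij(1)] N[OF ij(2)] unfolding parallelogram[of "x - m i" "x - m j"] by linarith
      then have "norm ((x - m i) - (x - m j)) < e"
        by (rule power2_less_imp_less) (use e in simp)
      then show "dist (m i) (m j) < e" by (simp add: dist_norm norm_minus_commute)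
    qed
  qed
  then obtain p where p: "m \<longlonglongrightarrow> p" using Cauchy_convergent convergent_def by blast
  have "(\<lambda>n. norm (x - m n)) \<longlonglongrightarrow> norm (x - p)" by (intro tendsto_intros p)
  then have "norm (x - p) = d" using lim LIMSEQ_unique by blast
  moreover have "p \<in> M" using assms(2) m(1) p closed_sequentially by blast
  ultimately show thesis using that le by auto
qed

text \<open>The closest point works: all translates of \<open>x - p\<close> by multiples of
  \<open>m\<close> in \<open>M\<close> are at least as long, which forces orthogonality.\<close>

lemma orthogonal_decomposition:
  fixes M :: "'a::complex_hilbert set"
  assumes "csubspace M" "closed M"
  obtains p where "p \<in> M" "\<And>m. m \<in> M \<Longrightarrow> cinner (x - p) m = 0"
proof -
  obtain p where p: "p \<in> M" "\<And>m. m \<in> M \<Longrightarrow> norm (x - p) \<le> norm (x - m)"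
    using closest_point_csubspace[OF assms] by blast
  have "cinner (x - p) m = 0" if "m \<in> M" for m
  proof (rule cinner_eq_0_if_minimal)
    fix c
    have "p + (- c) *\<^sub>C m \<in> M" using assms(1) p(1) that by (auto simp: csubspace_def)
    from p(2)[OF this] have "norm (x - p) \<le> norm (x - (p + (- c) *\<^sub>C m))" .
    moreover have "(- c) *\<^sub>C m + c *\<^sub>C m = 0" by (simp flip: scaleC_add_left)
    then have "x - (p + (- c) *\<^sub>C m) = x - p + c *\<^sub>C m"
      by (simp add: algebra_simps eq_neg_iff_add_eq_0)
    ultimately show "norm (x - p) \<le> norm (x - p + c *\<^sub>C m)" by simp
  qed
  with p(1) that show thesis by blast
qed

text \<open>The kernel of a nonzero \<open>f\<close> is a closed proper subspace, so some
  \<open>w\<close> outside it is orthogonal to it. Removing from \<open>x\<close> the multiple of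
  \<open>w\<close> with the same value of \<open>f\<close> lands in the kernel, and pairing with
  \<open>w\<close> recovers \<open>f x\<close>.\<close>

lemma Riesz_representation:
  fixes f :: "'a::complex_hilbert \<Rightarrow> complex"
  assumes "bounded_linear f" and sc: "\<And>c x. f (c *\<^sub>C x) = c * f x"
  shows "\<exists>z. \<forall>x. f x = cinner x z"
proof (cases "\<forall>x. f x = 0")
  case True
  then show ?thesis by (intro exI[of _ 0]) (simp add: cinner.zero_right)
next
  case False
  then obtain x0 where x0: "f x0 \<noteq> 0" by blast
  interpret f: bounded_linear f by fact
  define M where "M = {x. f x = 0}"
  have "csubspace M" by (simp add: csubspace_def M_def f.add f.zero sc)
  moreover have "closed M" unfolding M_def
    by (intro closed_Collect_eq f.continuous_on continuous_on_id continuous_on_const)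
  ultimately obtain p where p: "p \<in> M" "\<And>m. m \<in> M \<Longrightarrow> cinner (x0 - p) m = 0"
    using orthogonal_decomposition by blast
  define w where "w = x0 - p"
  have fw: "f w \<noteq> 0" using x0 p(1) by (simp add: w_def f.diff M_def)
  then have w: "w \<noteq> 0" using f.zero by auto
  \<comment> \<open>The scalar is conjugated because the inner product is conjugate linear in its
    second argument; its size is fixed by the case where \<open>x\<close> is
    \<open>w\<close>.\<close>
  have "f x = cinner x (cnj (f w / cinner w w) *\<^sub>C w)" for x
  proof -
    have "x - (f x / f w) *\<^sub>C w \<in> M" using fw by (simp add: M_def f.diff sc)
    then have "cinner (x - (f x / f w) *\<^sub>C w) w = 0"
      using p(2) w_def cinner_eq_0_sym by blast
    then have "cinner x w = f x / f w * cinner w w"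
      by (simp add: cinner.diff_left cinner_scaleC_left)
    then show ?thesis using fw w by (simp add: cinner_scaleC_right)
  qed
  then show ?thesis by blast
qed

section \<open>Bounded operators and existence of adjoints\<close>

lemma bounded_clinearD:
  assumes "bounded_clinear A"
  shows "bounded_linear A" "A (c *\<^sub>C x) = c *\<^sub>C A x"
  using assms by (auto simp: bounded_clinear_def)

lemma bounded_clinear_compose:
  assumes "bounded_clinear A" "bounded_clinear B"
  shows "bounded_clinear (A \<circ> B)"
  using assms bounded_linear_compose[of A B] by (auto simp: bounded_clinear_def o_def)

text \<open>Nondegeneracy of the inner product transfers linearity to \<open>B\<close>. The bound
  comes from |By|^2 = <A(By), y> by Cauchy-Schwarz and cancellation of one factor |By|.\<close>

lemma bounded_clinear_if_adjoint:
  fixes A B :: "'a::complex_hilbert \<Rightarrow> 'a"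
  assumes A: "bounded_linear A" and adj: "\<And>x y. cinner (A x) y = cinner x (B y)"
  shows "bounded_clinear B"
proof -
  obtain K where K: "\<And>x. norm (A x) \<le> norm x * K" "K \<ge> 0"
    using bounded_linear.nonneg_bounded[OF A] by blast
  have sc: "B (c *\<^sub>C y) = c *\<^sub>C B y" for c y
    by (rule cinner_ext) (simp add: cinner_scaleC_right flip: adj)
  have "bounded_linear B"
  proof (rule bounded_linear_intro[where K = K])
    show "B (y + z) = B y + B z" for y z
      by (rule cinner_ext) (simp add: cinner_add_right flip: adj)
    show "B (r *\<^sub>R y) = r *\<^sub>R B y" for r y
      by (rule cinner_ext) (simp add: cinner_scaleR_right flip: adj)
    show "norm (B y) \<le> norm y * K" for y
    proof (cases "B y = 0")
      case True
      then show ?thesis using K(2) by simp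
    next
      case False
      have "(norm (B y))\<^sup>2 = cmod (cinner (A (B y)) y)" by (simp add: norm_eq_cmod_cinner adj)
      also have "\<dots> \<le> norm (A (B y)) * norm y" by (rule Cauchy_Schwarz_cinner)
      also have "\<dots> \<le> (norm (B y) * K) * norm y" using K(1) by (simp add: mult_right_mono)
      finally have "norm (B y) * norm (B y) \<le> norm (B y) * (norm y * K)"
        by (simp add: power2_eq_square mult_ac)
      then show ?thesis using False by simp
    qed
  qed
  with sc show ?thesis by (simp add: bounded_clinear_def)
qed

lemma cadjoint_eqI:
  fixes A B :: "'a::complex_hilbert \<Rightarrow> 'a"
  assumes "bounded_clinear B" "\<And>x y. cinner (A x) y = cinner x (B y)"
  shows "cadjoint A = B"
  unfolding cadjoint_def
proof (rule the_equality)
  fix B' assume "bounded_clinear B' \<and> (\<forall>x y. cinner (A x) y = cinner x (B' y))"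
  then show "B' = B" using assms(2) by (intro ext cinner_ext) metis
qed (use assms in auto)

text \<open>For each fixed \<open>y\<close>, Riesz representation applies to the bounded functional
  sending \<open>x\<close> to \<open>cinner (A x) y\<close>; the representing vectors form the
  adjoint.\<close>

lemma cadjoint:
  fixes A :: "'a::complex_hilbert \<Rightarrow> 'a"
  assumes "bounded_clinear A"
  shows "bounded_clinear (cadjoint A)" "cinner (A x) y = cinner x (cadjoint A y)"
proof -
  note A = bounded_clinearD[OF assms]
  have "\<exists>z. \<forall>x. cinner (A x) y = cinner x z" for y
  proof (rule Riesz_representation)
    show "bounded_linear (\<lambda>x. cinner (A x) y)"
      by (rule bounded_linear_compose[OF cinner.bounded_linear_left A(1)])
  qed (simp add: A(2) cinner_scaleC_left)
  then obtain B where B: "\<And>x y. cinner (A x) y = cinner x (B y)" by metis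
  have "bounded_clinear B" using A(1) B by (rule bounded_clinear_if_adjoint)
  moreover from this B have "cadjoint A = B" by (rule cadjoint_eqI)
  ultimately show "bounded_clinear (cadjoint A)" "cinner (A x) y = cinner x (cadjoint A y)"
    using B by auto
qed

section \<open>Positive operators and square roots\<close>

text \<open>The defect \<open>\<delta>\<close> is a sesquilinear form that vanishes on the diagonal,
  since \<open>cinner (A x) x\<close> is real. Polarization over the complex numbers then makes it
  zero everywhere.\<close>

lemma positive_op_self_adjoint:
  fixes A :: "'a::complex_hilbert \<Rightarrow> 'a"
  assumes "positive_op A"
  shows "cinner (A x) y = cinner x (A y)"
proof -
  have A: "bounded_clinear A" using assms by (simp add: positive_op_def)
  interpret A: bounded_linear A using A by (rule bounded_clinearD)
  define \<delta> where "\<delta> x y = cinner (A x) y - cinner x (A y)" for x y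
  have d0: "\<delta> x x = 0" for x
  proof -
    have "cinner (A x) x \<in> \<real>"
      using assms nonneg_Reals_subset_Reals by (auto simp: positive_op_def)
    then show ?thesis by (metis \<delta>_def Reals_cnj_iff cinner_commute right_minus_eq)
  qed
  have anti: "\<delta> x y + \<delta> y x = 0" for x y
    using d0[of "x + y"] d0[of x] d0[of y]
    by (simp add: \<delta>_def A.add cinner_add_left cinner_add_right algebra_simps)
  \<comment> \<open>Replacing x by ix turns the antisymmetry \<open>anti\<close> into symmetry; the
    two together give zero.\<close>
  have "\<delta> (\<i> *\<^sub>C x) y = \<i> * \<delta> x y" "\<delta> y (\<i> *\<^sub>C x) = - \<i> * \<delta> y x"
    by (simp_all add: \<delta>_def bounded_clinearD(2)[OF A] cinner_scaleC_left cinner_scaleC_right algebra_simps)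
  with anti[of "\<i> *\<^sub>C x" y] have "\<i> * (\<delta> x y - \<delta> y x) = 0" by (simp add: algebra_simps)
  with anti[of x y] have "\<delta> x y = 0" by simp
  then show ?thesis by (simp add: \<delta>_def)
qed

text \<open>Along the line \<open>y + t *\<^sub>R A y\<close> the nonnegative form is a quadratic in
  \<open>t\<close> without constant term, so its linear coefficient, twice |Ay|^2, must
  vanish.\<close>

lemma positive_op_cinner_eq_0:
  fixes A :: "'a::complex_hilbert \<Rightarrow> 'a"
  assumes "positive_op A" and "cinner (A y) y = 0"
  shows "A y = 0"
proof -
  interpret A: bounded_linear A using assms by (simp add: positive_op_def bounded_clinear_def)
  define b c where "b = (norm (A y))\<^sup>2" and "c = Re (cinner (A (A y)) (A y))"
  have pos: "0 \<le> Re (cinner (A z) z)" for z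
    using assms(1) by (simp add: positive_op_def complex_nonneg_Reals_iff)
  have c: "c \<ge> 0" by (simp add: c_def pos)
  have quad: "0 \<le> 2 * t * b + t\<^sup>2 * c" for t
  proof -
    let ?z = "y + t *\<^sub>R A y"
    have "cinner (A (A y)) y = cinner (A y) (A y)" by (rule positive_op_self_adjoint[OF assms(1)])
    then have "cinner (A ?z) ?z = of_real t * cinner (A y) (A y) * 2
        + of_real (t\<^sup>2) * cinner (A (A y)) (A y)"
      using assms(2)
      by (simp add: A.add A.scaleR cinner_add_left cinner_add_right cinner_scaleR_left
          cinner_scaleR_right scaleR_conv_of_real power2_eq_square algebra_simps)
    then have "Re (cinner (A ?z) ?z) = 2 * t * b + t\<^sup>2 * c"
      by (simp only: cinner_self b_def c_def) (simp flip: of_real_power)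
    then show ?thesis using pos[of ?z] by simp
  qed
  have "b \<ge> 0" by (simp add: b_def)
  have "b = 0"
  proof (rule ccontr)
    assume "b \<noteq> 0"
    with \<open>b \<ge> 0\<close> have b: "b > 0" by simp
    \<comment> \<open>A negative \<open>t\<close> so small that the linear term dominates; adding 1
      keeps the denominator positive when \<open>c\<close> is 0.\<close>
    define t where "t = - b / (c + 1)"
    have t: "t < 0" using b c by (simp add: t_def)
    have "t * (2 * b + t * c) \<ge> 0" using quad[of t] by (simp add: power2_eq_square algebra_simps)
    then have "2 * b + t * c \<le> 0" using t by (simp add: zero_le_mult_iff)
    moreover have "- t * c \<le> b" using b c by (simp add: t_def field_simps)
    ultimately show False using b by linarith
  qed
  then show ?thesis by (simp add: b_def)
qed

section \<open>Existence of positive square roots by iteration\<close>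

text \<open>If \<open>Y\<close> is the limit of this iteration, then \<open>(1 - Y)\<^sup>2 = 1 - X\<close>.\<close>

primrec sqrt_iter :: "('a::real_normed_vector \<Rightarrow>\<^sub>L 'a) \<Rightarrow> nat \<Rightarrow> 'a \<Rightarrow>\<^sub>L 'a" where
  "sqrt_iter X 0 = 0"
| "sqrt_iter X (Suc n) = (1/2) *\<^sub>R (X + (sqrt_iter X n o\<^sub>L sqrt_iter X n))"

text \<open>The same iteration for the scalar \<open>X = 1\<close> majorizes it.\<close>

primrec sqrt_iter_real :: "nat \<Rightarrow> real" where
  "sqrt_iter_real 0 = 0"
| "sqrt_iter_real (Suc n) = (1/2) * (1 + sqrt_iter_real n * sqrt_iter_real n)"

lemma sqrt_iter_real_bounds: "0 \<le> sqrt_iter_real n" "sqrt_iter_real n \<le> 1"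
proof -
  have "0 \<le> sqrt_iter_real n \<and> sqrt_iter_real n \<le> 1"
    by (induction n) (auto intro: mult_le_one)
  then show "0 \<le> sqrt_iter_real n" "sqrt_iter_real n \<le> 1" by auto
qed

lemma sqrt_iter_real_Suc_ge: "sqrt_iter_real n \<le> sqrt_iter_real (Suc n)"
proof -
  have "0 \<le> (1 - sqrt_iter_real n)\<^sup>2" by simp
  then show ?thesis by (simp add: power2_eq_square algebra_simps)
qed

text \<open>The scalar iteration is increasing and bounded. Its Cauchy property is what majorization
  passes on to the operator iteration.\<close>

lemma Cauchy_sqrt_iter_real: "Cauchy sqrt_iter_real"
proof -
  have "convergent sqrt_iter_real"
  proof (rule Bseq_mono_convergent)
    show "Bseq sqrt_iter_real" using sqrt_iter_real_bounds by (intro BseqI'[of _ 1]) auto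
    show "\<forall>m n. m \<le> n \<longrightarrow> sqrt_iter_real m \<le> sqrt_iter_real n"
      using lift_Suc_mono_le[of sqrt_iter_real] sqrt_iter_real_Suc_ge by blast
  qed
  then show ?thesis by (rule convergent_Cauchy)
qed

lemmas blinfun_compose_linear =
  bounded_bilinear.add_left[OF bounded_bilinear_blinfun_compose]
  bounded_bilinear.add_right[OF bounded_bilinear_blinfun_compose]
  bounded_bilinear.diff_left[OF bounded_bilinear_blinfun_compose]
  bounded_bilinear.diff_right[OF bounded_bilinear_blinfun_compose]
  bounded_bilinear.scaleR_left[OF bounded_bilinear_blinfun_compose]
  bounded_bilinear.scaleR_right[OF bounded_bilinear_blinfun_compose]
  bounded_bilinear.zero_left[OF bounded_bilinear_blinfun_compose]
  bounded_bilinear.zero_right[OF bounded_bilinear_blinfun_compose]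

lemma blinfun_compose_assoc': "(A o\<^sub>L B) o\<^sub>L C = A o\<^sub>L (B o\<^sub>L C)"
  by (rule blinfun_eqI) simp

text \<open>Each iterate is a polynomial in \<open>X\<close>. In particular any two iterates commute
  with each other.\<close>

lemma sqrt_iter_commute:
  assumes "Z o\<^sub>L X = X o\<^sub>L Z"
  shows "Z o\<^sub>L sqrt_iter X n = sqrt_iter X n o\<^sub>L Z"
proof (induction n)
  case (Suc n)
  have "Z o\<^sub>L (sqrt_iter X n o\<^sub>L sqrt_iter X n) = (sqrt_iter X n o\<^sub>L sqrt_iter X n) o\<^sub>L Z"
    by (metis Suc blinfun_compose_assoc')
  then show ?case using assms by (simp add: blinfun_compose_linear)
qed (simp add: blinfun_compose_linear)

lemma norm_sqrt_iter_le:
  assumes "norm X \<le> 1"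
  shows "norm (sqrt_iter X n) \<le> sqrt_iter_real n"
proof (induction n)
  case (Suc n)
  have "norm (sqrt_iter X n o\<^sub>L sqrt_iter X n) \<le> norm (sqrt_iter X n) * norm (sqrt_iter X n)"
    by (rule norm_blinfun_compose)
  also have "\<dots> \<le> sqrt_iter_real n * sqrt_iter_real n"
    using Suc sqrt_iter_real_bounds by (intro mult_mono) auto
  finally show ?case
    using norm_triangle_ineq[of X "sqrt_iter X n o\<^sub>L sqrt_iter X n"] assms by simp
qed simp

text \<open>For commuting consecutive iterates A and B, the next increment is half of A^2 - B^2 = (A
  + B)(A - B). Each factor is majorized by its scalar counterpart, and the scalar increments factor
  in the same way.\<close>

lemma norm_sqrt_iter_diff_Suc_le:
  assumes "norm X \<le> 1"
  shows "norm (sqrt_iter X (Suc n) - sqrt_iter X n) \<le> sqrt_iter_real (Suc n) - sqrt_iter_real n"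
proof (induction n)
  case 0
  then show ?case using assms by (simp add: blinfun_compose_linear)
next
  case (Suc n)
  define A B where "A = sqrt_iter X (Suc n)" and "B = sqrt_iter X n"
  define a b where "a = sqrt_iter_real (Suc n)" and "b = sqrt_iter_real n"
  have "A o\<^sub>L B = B o\<^sub>L A"
    unfolding A_def B_def by (intro sqrt_iter_commute sqrt_iter_commute[symmetric] refl)
  then have "sqrt_iter X (Suc (Suc n)) - A = (1/2) *\<^sub>R ((A + B) o\<^sub>L (A - B))"
    by (simp only: sqrt_iter.simps(2)[of X "Suc n"] A_def[symmetric])
      (simp add: A_def B_def[symmetric] blinfun_compose_linear algebra_simps)
  then have "norm (sqrt_iter X (Suc (Suc n)) - A) = (1/2) * norm ((A + B) o\<^sub>L (A - B))" by simp
  also have "\<dots> \<le> (1/2) * (norm (A + B) * norm (A - B))" by (simp add: norm_blinfun_compose)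
  also have "\<dots> \<le> (1/2) * ((a + b) * (a - b))"
  proof (intro mult_left_mono mult_mono)
    show "norm (A + B) \<le> a + b"
      using norm_sqrt_iter_le[OF assms] norm_triangle_ineq[of A B] unfolding A_def B_def a_def b_def
      by (meson add_mono order_trans)
    show "norm (A - B) \<le> a - b" using Suc unfolding A_def B_def a_def b_def .
    show "0 \<le> a + b" using sqrt_iter_real_bounds unfolding a_def b_def by (meson add_nonneg_nonneg)
  qed auto
  also have "\<dots> = sqrt_iter_real (Suc (Suc n)) - a"
    by (simp only: sqrt_iter_real.simps(2)[of "Suc n"] a_def[symmetric])
      (simp add: a_def b_def[symmetric] algebra_simps)
  finally show ?case by (simp only: A_def a_def)
qed

text \<open>Telescoping bounds the norm of a difference of any two iterates by the difference of the
  scalar iterates.\<close>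

lemma Cauchy_sqrt_iter:
  assumes "norm X \<le> 1"
  shows "Cauchy (sqrt_iter X)"
proof -
  have diff: "norm (sqrt_iter X (n + k) - sqrt_iter X n) \<le> sqrt_iter_real (n + k) - sqrt_iter_real n" for n k
  proof (induction k)
    case (Suc k)
    have "norm (sqrt_iter X (Suc (n + k)) - sqrt_iter X n)
      \<le> norm (sqrt_iter X (Suc (n + k)) - sqrt_iter X (n + k)) + norm (sqrt_iter X (n + k) - sqrt_iter X n)"
      by (rule norm_diff_triangle_le[OF order_refl order_refl])
    also have "\<dots> \<le> (sqrt_iter_real (Suc (n + k)) - sqrt_iter_real (n + k))
        + (sqrt_iter_real (n + k) - sqrt_iter_real n)"
      by (intro add_mono norm_sqrt_iter_diff_Suc_le assms Suc)
    finally show ?case by simp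
  qed simp
  show ?thesis
  proof (rule CauchyI')
    fix e :: real assume "e > 0"
    then obtain N where N: "\<And>m n. m \<ge> N \<Longrightarrow> n \<ge> N \<Longrightarrow> norm (sqrt_iter_real m - sqrt_iter_real n) < e"
      using CauchyD[OF Cauchy_sqrt_iter_real] by blast
    show "\<exists>M. \<forall>m\<ge>M. \<forall>n>m. dist (sqrt_iter X m) (sqrt_iter X n) < e"
    proof (intro exI allI impI)
      fix m n assume mn: "m \<ge> N" "n > m"
      have "dist (sqrt_iter X m) (sqrt_iter X n) = norm (sqrt_iter X (m + (n - m)) - sqrt_iter X m)"
        using mn by (simp add: dist_norm norm_minus_commute)
      also have "\<dots> \<le> sqrt_iter_real (m + (n - m)) - sqrt_iter_real m" by (rule diff)
      also have "\<dots> < e" using N[of n m] mn by simp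
      finally show "dist (sqrt_iter X m) (sqrt_iter X n) < e" .
    qed
  qed
qed

text \<open>\<open>Y\<close> is the norm limit of the iteration. The bound, complex homogeneity,
  symmetry and commutation hold for every iterate and pass to the limit; commutation is recorded
  because uniqueness of the square root rests on it.\<close>

lemma exists_sqrt_op_contraction:
  fixes X :: "'a::complex_hilbert \<Rightarrow>\<^sub>L 'a"
  assumes nX: "norm X \<le> 1"
    and scX: "\<And>c x. X (c *\<^sub>C x) = c *\<^sub>C X x"
    and adjX: "\<And>x y. cinner (X x) y = cinner x (X y)"
  obtains Y :: "'a \<Rightarrow>\<^sub>L 'a" where "norm Y \<le> 1" "2 *\<^sub>R Y = X + (Y o\<^sub>L Y)"
    "\<And>c x. Y (c *\<^sub>C x) = c *\<^sub>C Y x" "\<And>x y. cinner (Y x) y = cinner x (Y y)"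
    "\<And>Z. Z o\<^sub>L X = X o\<^sub>L Z \<Longrightarrow> Z o\<^sub>L Y = Y o\<^sub>L Z"
proof -
  note comp_tendsto = bounded_bilinear.tendsto[OF bounded_bilinear_blinfun_compose]
  obtain Y where Y: "sqrt_iter X \<longlonglongrightarrow> Y"
    using Cauchy_sqrt_iter[OF nX] Cauchy_convergent convergent_def by blast
  have Yx: "(\<lambda>n. sqrt_iter X n x) \<longlonglongrightarrow> Y x" for x
    by (intro tendsto_intros Y)
  have sc: "sqrt_iter X n (c *\<^sub>C x) = c *\<^sub>C sqrt_iter X n x" for n c x
  proof (induction n arbitrary: x)
    case (Suc n)
    then show ?case
      by (simp add: blinfun.add_left blinfun.scaleR_left scX scaleC_add_right
          bounded_linear.linear[OF bounded_linear_scaleC, THEN linear_scale])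
  qed simp
  have adj: "cinner (sqrt_iter X n x) y = cinner x (sqrt_iter X n y)" for n x y
    by (induction n arbitrary: x y)
      (simp_all add: cinner.zero_left cinner.zero_right blinfun.add_left blinfun.scaleR_left adjX
        cinner_add_left cinner_add_right cinner_scaleR_left cinner_scaleR_right)
  show thesis
  proof
    have "norm (sqrt_iter X n) \<le> 1" for n
      using norm_sqrt_iter_le[OF nX] sqrt_iter_real_bounds(2) order_trans by blast
    then show "norm Y \<le> 1" using tendsto_norm[OF Y] by (intro LIMSEQ_le_const2) auto
    have "(\<lambda>n. sqrt_iter X (Suc n)) \<longlonglongrightarrow> (1/2) *\<^sub>R (X + (Y o\<^sub>L Y))"
      unfolding sqrt_iter.simps by (intro tendsto_intros comp_tendsto Y)
    moreover have "(\<lambda>n. sqrt_iter X (Suc n)) \<longlonglongrightarrow> Y" using Y by (rule LIMSEQ_Suc)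
    ultimately have "Y = (1/2) *\<^sub>R (X + (Y o\<^sub>L Y))" using LIMSEQ_unique by blast
    then have "2 *\<^sub>R Y = 2 *\<^sub>R ((1/2) *\<^sub>R (X + (Y o\<^sub>L Y)))" by (rule arg_cong)
    then show "2 *\<^sub>R Y = X + (Y o\<^sub>L Y)" by simp
    show "Y (c *\<^sub>C x) = c *\<^sub>C Y x" for c x
    proof (rule LIMSEQ_unique[OF Yx])
      show "(\<lambda>n. sqrt_iter X n (c *\<^sub>C x)) \<longlonglongrightarrow> c *\<^sub>C Y x"
        unfolding sc by (rule bounded_linear.tendsto[OF bounded_linear_scaleC Yx])
    qed
    show "cinner (Y x) y = cinner x (Y y)" for x y
    proof (rule LIMSEQ_unique)
      show "(\<lambda>n. cinner (sqrt_iter X n x) y) \<longlonglongrightarrow> cinner (Y x) y"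
        by (intro cinner.tendsto Yx tendsto_const)
      show "(\<lambda>n. cinner (sqrt_iter X n x) y) \<longlonglongrightarrow> cinner x (Y y)"
        unfolding adj by (intro cinner.tendsto Yx tendsto_const)
    qed
    show "Z o\<^sub>L Y = Y o\<^sub>L Z" if "Z o\<^sub>L X = X o\<^sub>L Z" for Z
    proof (rule LIMSEQ_unique)
      show "(\<lambda>n. Z o\<^sub>L sqrt_iter X n) \<longlonglongrightarrow> (Z o\<^sub>L Y)" by (intro comp_tendsto Y tendsto_const)
      show "(\<lambda>n. Z o\<^sub>L sqrt_iter X n) \<longlonglongrightarrow> (Y o\<^sub>L Z)"
        unfolding sqrt_iter_commute[OF that] by (intro comp_tendsto Y tendsto_const)
    qed
  qed
qed

text \<open>With A the composite \<open>cadjoint C \<circ> C\<close>, the operator X = 1 - A/k is a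
  contraction for suitable k. The solution Y of (1 - Y)^2 = 1 - X = A/k then gives the root sqrt(k)
  (1 - Y).\<close>

lemma exists_positive_sqrt:
  fixes C :: "'a::complex_hilbert \<Rightarrow> 'a"
  assumes C: "bounded_clinear C"
  obtains S where "positive_op S" "S \<circ> S = cadjoint C \<circ> C"
    "\<And>Z. bounded_linear Z \<Longrightarrow> Z \<circ> (cadjoint C \<circ> C) = (cadjoint C \<circ> C) \<circ> Z \<Longrightarrow> Z \<circ> S = S \<circ> Z"
proof -
  define A where "A = cadjoint C \<circ> C"
  note Cs = cadjoint[OF C]
  have "bounded_clinear A" unfolding A_def by (intro bounded_clinear_compose Cs C)
  note A = bounded_clinearD[OF this]
  have AC: "cinner (A x) y = cinner (C x) (C y)" for x y
    by (metis A_def Cs(2) cinner_commute comp_apply)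
  have AC': "cinner x (A y) = cinner (C x) (C y)" for x y
    by (simp add: A_def Cs(2))
  obtain K where K: "K > 0" "\<And>x. norm (cadjoint C x) \<le> norm x * K"
    using bounded_linear.pos_bounded[OF bounded_clinearD(1)[OF Cs(1)]] by blast
  \<comment> \<open>With \<open>K\<close> a bound for the adjoint, |Ax|^2 is at most k |Cx|^2. This
    absorbs the quadratic term in the expansion of |x - Ax/k|^2.\<close>
  define k where "k = K\<^sup>2"
  have k: "k > 0" using K by (simp add: k_def)
  define X where "X = id_blinfun - (1/k) *\<^sub>R Blinfun A"
  have X: "X x = x - (1/k) *\<^sub>R A x" for x
    by (simp add: X_def blinfun.diff_left blinfun.scaleR_left bounded_linear_Blinfun_apply A(1))
  have scR: "c *\<^sub>C r *\<^sub>R x = r *\<^sub>R c *\<^sub>C x" and scD: "c *\<^sub>C (x - y) = c *\<^sub>C x - c *\<^sub>C y" for c r and x y :: 'a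
    using bounded_linear.linear[OF bounded_linear_scaleC, THEN linear_scale, of c r x]
      bounded_linear.linear[OF bounded_linear_scaleC, THEN linear_diff, of c x y] by auto
  have normX: "norm X \<le> 1"
  proof (rule norm_blinfun_bound)
    fix x
    have "(norm (A x))\<^sup>2 \<le> (norm (C x) * K)\<^sup>2" unfolding A_def using K(2) by (simp add: power_mono)
    then have b: "(norm (A x))\<^sup>2 \<le> k * (norm (C x))\<^sup>2" by (simp add: k_def power_mult_distrib mult.commute)
    have "cinner x (- ((1/k) *\<^sub>R A x)) = of_real (- (1/k) * (norm (C x))\<^sup>2)"
      by (simp add: cinner.minus_right cinner_scaleR_right AC' cinner_self scaleR_conv_of_real)
    then have "Re (cinner x (- ((1/k) *\<^sub>R A x))) = - (1/k) * (norm (C x))\<^sup>2" by (simp only: Re_complex_of_real)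
    then have "(norm (X x))\<^sup>2 = (norm x)\<^sup>2 + (norm (A x))\<^sup>2 / k\<^sup>2 - 2 * (norm (C x))\<^sup>2 / k"
      using norm_add_sq[of x "- ((1/k) *\<^sub>R A x)"] k by (simp add: X power_divide)
    also have "(norm (A x))\<^sup>2 / k\<^sup>2 \<le> (norm (C x))\<^sup>2 / k"
      using b k by (simp add: field_simps power2_eq_square)
    finally have "(norm (X x))\<^sup>2 \<le> (norm x)\<^sup>2 - (norm (C x))\<^sup>2 / k" by simp
    moreover have "(norm (C x))\<^sup>2 / k \<ge> 0" using k by simp
    ultimately have "(norm (X x))\<^sup>2 \<le> (norm x)\<^sup>2" by linarith
    then have "norm (X x) \<le> norm x" by (rule power2_le_imp_le) simp
    then show "norm (X x) \<le> 1 * norm x" by simp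
  qed simp
  have scX: "X (c *\<^sub>C x) = c *\<^sub>C X x" for c x by (simp add: X A scR scD)
  have adjX: "cinner (X x) y = cinner x (X y)" for x y
    by (simp add: X cinner.diff_left cinner.diff_right cinner_scaleR_left cinner_scaleR_right AC AC')
  obtain Y where Y: "norm Y \<le> 1" "2 *\<^sub>R Y = X + (Y o\<^sub>L Y)"
    "\<And>c x. Y (c *\<^sub>C x) = c *\<^sub>C Y x" "\<And>x y. cinner (Y x) y = cinner x (Y y)"
    "\<And>Z. Z o\<^sub>L X = X o\<^sub>L Z \<Longrightarrow> Z o\<^sub>L Y = Y o\<^sub>L Z"
    using exists_sqrt_op_contraction[OF normX scX adjX] by metis
  define S where "S x = sqrt k *\<^sub>R (x - Y x)" for x
  have blS: "bounded_linear S" unfolding S_def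
    by (intro bounded_linear_intros)
  show thesis
  proof
    have "cinner (S x) x \<in> \<real>\<^sub>\<ge>\<^sub>0" for x
    proof -
      \<comment> \<open>Symmetry of \<open>Y\<close> makes this value real, and contractivity bounds
        it by |x|^2; hence 1 - Y is positive.\<close>
      have "cinner (Y x) x \<in> \<real>" by (metis Y(4) Reals_cnj_iff cinner_commute)
      then have "Im (cinner (Y x) x) = 0" by (simp add: complex_is_Real_iff)
      moreover have "Re (cinner (Y x) x) \<le> (norm x)\<^sup>2"
      proof -
        have "Re (cinner (Y x) x) \<le> norm (Y x) * norm x"
          using complex_Re_le_cmod Cauchy_Schwarz_cinner order_trans by blast
        also have "norm (Y x) \<le> norm x"
          using norm_blinfun[of Y x] Y(1) by (metis mult_left_le_one_le norm_ge_zero order_trans)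
        finally show ?thesis by (simp add: power2_eq_square mult_right_mono)
      qed
      ultimately show ?thesis using k
        by (simp add: S_def cinner_scaleR_left cinner.diff_left cinner_self complex_nonneg_Reals_iff
          flip: of_real_power)
    qed
    then show "positive_op S"
      using blS by (simp add: positive_op_def bounded_clinear_def S_def Y(3) scR scD)
    have "S (S x) = A x" for x
    proof -
      have "2 *\<^sub>R Y x = X x + Y (Y x)" 
        using arg_cong[OF Y(2), of "\<lambda>f. blinfun_apply f x"] by (simp add: blinfun.add_left blinfun.scaleR_left)
      then have "Y x + Y x - Y (Y x) = x - (1/k) *\<^sub>R A x" by (simp add: X scaleR_2 algebra_simps)
      then have "k *\<^sub>R (x - (Y x + Y x - Y (Y x))) = A x" using k by simp
      then show ?thesis using k
        by (simp add: S_def blinfun.scaleR_right blinfun.diff_right algebra_simps)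
    qed
    then show "S \<circ> S = cadjoint C \<circ> C" by (auto simp: A_def)
    show "Z \<circ> S = S \<circ> Z"
      if Z: "bounded_linear Z" "Z \<circ> (cadjoint C \<circ> C) = (cadjoint C \<circ> C) \<circ> Z" for Z
    proof -
      interpret Z: bounded_linear Z by fact
      have ZA: "Z (A x) = A (Z x)" for x using fun_cong[OF Z(2)] by (simp add: A_def)
      have "Blinfun Z o\<^sub>L X = X o\<^sub>L Blinfun Z"
        by (rule blinfun_eqI) (simp add: bounded_linear_Blinfun_apply Z(1) X Z.diff Z.scaleR ZA)
      then have ZY: "Blinfun Z o\<^sub>L Y = Y o\<^sub>L Blinfun Z" by (rule Y(5))
      have ZYx: "Z (Y x) = Y (Z x)" for x
        using arg_cong[OF ZY, of "\<lambda>f. blinfun_apply f x"] by (simp add: bounded_linear_Blinfun_apply Z(1))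
      show ?thesis by (simp add: fun_eq_iff S_def Z.scaleR Z.diff ZYx)
    qed
  qed
qed

text \<open>For y = Bx - Sx, commutation gives (B + S)y = (B^2 - S^2)x = 0. Two nonnegative forms
  with sum zero both vanish at y, so By = Sy = 0, and self-adjointness gives |y|^2 = <x, By> - <x,
  Sy> = 0.\<close>

lemma positive_sqrt_unique:
  fixes B S :: "'a::complex_hilbert \<Rightarrow> 'a"
  assumes B: "positive_op B" and S: "positive_op S" and sq: "B \<circ> B = S \<circ> S" and com: "B \<circ> S = S \<circ> B"
  shows "B = S"
proof (rule ext)
  fix x
  interpret B: bounded_linear B using B by (simp add: positive_op_def bounded_clinear_def)
  interpret S: bounded_linear S using S by (simp add: positive_op_def bounded_clinear_def)
  define y where "y = B x - S x"
  have "B (B x) = S (S x)" "B (S x) = S (B x)" using fun_cong[OF sq] fun_cong[OF com] by auto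
  then have "B y + S y = 0" by (simp add: y_def B.diff S.diff)
  then have "cinner (B y) y + cinner (S y) y = 0" by (simp add: cinner.zero_left flip: cinner_add_left)
  moreover have "cinner (B y) y \<in> \<real>\<^sub>\<ge>\<^sub>0" "cinner (S y) y \<in> \<real>\<^sub>\<ge>\<^sub>0" using B S by (auto simp: positive_op_def)
  ultimately have "cinner (B y) y = 0" "cinner (S y) y = 0"
    by (auto simp: complex_nonneg_Reals_iff complex_eq_iff)
  then have "B y = 0" "S y = 0" using B S positive_op_cinner_eq_0 by blast+
  then have "cinner (B x) y = 0" "cinner (S x) y = 0"
    by (simp_all add: positive_op_self_adjoint[OF B] positive_op_self_adjoint[OF S] cinner.zero_right)
  then have "cinner (B x - S x) y = 0" by (simp add: cinner.diff_left)
  then have "cinner y y = 0" by (simp only: y_def)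
  then show "B x = S x" by (simp add: y_def)
qed

text \<open>Any competing positive root \<open>B\<close> commutes with its own square
  \<open>cadjoint C \<circ> C\<close>, hence with the constructed root \<open>S\<close>. So
  uniqueness among commuting roots suffices to resolve the definite description.\<close>

lemma abs_op:
  fixes C :: "'a::complex_hilbert \<Rightarrow> 'a"
  assumes "bounded_clinear C"
  shows "positive_op (abs_op C)" "abs_op C \<circ> abs_op C = cadjoint C \<circ> C"
proof -
  obtain S where S: "positive_op S" "S \<circ> S = cadjoint C \<circ> C"
    "\<And>Z. bounded_linear Z \<Longrightarrow> Z \<circ> (cadjoint C \<circ> C) = (cadjoint C \<circ> C) \<circ> Z \<Longrightarrow> Z \<circ> S = S \<circ> Z"
    using exists_positive_sqrt[OF assms] by blast
  have "abs_op C = S"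
    unfolding abs_op_def sqrt_op_def
  proof (rule the_equality)
    show "positive_op S \<and> S ^^ 2 = cadjoint C \<circ> C" using S by (simp add: numeral_2_eq_2)
    fix B assume "positive_op B \<and> B ^^ 2 = cadjoint C \<circ> C"
    then have B: "positive_op B" "B \<circ> B = cadjoint C \<circ> C" by (auto simp: numeral_2_eq_2)
    show "B = S"
    proof (rule positive_sqrt_unique[OF B(1) S(1)])
      show "B \<circ> B = S \<circ> S" using B S by simp
      have "B \<circ> (cadjoint C \<circ> C) = (cadjoint C \<circ> C) \<circ> B" by (simp only: B(2)[symmetric] o_assoc)
      then show "B \<circ> S = S \<circ> B" using B(1) by (intro S(3)) (auto simp: positive_op_def bounded_clinear_def)
    qed
  qed
  with S show "positive_op (abs_op C)" "abs_op C \<circ> abs_op C = cadjoint C \<circ> C" by auto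
qed

lemma norm_abs_op:
  fixes C :: "'a::complex_hilbert \<Rightarrow> 'a"
  assumes "bounded_clinear C"
  shows "norm (abs_op C x) = norm (C x)"
proof -
  have "cinner (abs_op C x) (abs_op C x) = cinner x ((abs_op C \<circ> abs_op C) x)"
    using positive_op_self_adjoint[OF abs_op(1)[OF assms]] by simp
  also have "\<dots> = cinner (C x) (C x)" by (simp add: abs_op(2)[OF assms] cadjoint(2)[OF assms])
  finally have "(norm (abs_op C x))\<^sup>2 = (norm (C x))\<^sup>2" by (simp add: norm_eq_cmod_cinner)
  then show ?thesis by (simp add: power2_eq_iff_nonneg)
qed

section \<open>Polar decomposition\<close>

text \<open>Keeping the sequence of preimages \<open>x\<close> allows a second operator to be
  evaluated along the same sequence.\<close>

lemma closure_range_iff_LIMSEQ: "p \<in> closure (range S) \<longleftrightarrow> (\<exists>x. (\<lambda>n. S (x n)) \<longlonglongrightarrow> p)"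
  for S :: "'b \<Rightarrow> 'a::first_countable_topology"
proof
  assume "p \<in> closure (range S)"
  then obtain v where v: "\<forall>n. v n \<in> range S" "v \<longlonglongrightarrow> p" unfolding closure_sequential by blast
  have "\<forall>n. \<exists>x. v n = S x" using v(1) by blast
  then obtain x where "\<forall>n. v n = S (x n)" by (rule choice[THEN exE])
  then have "v = (\<lambda>n. S (x n))" by (simp add: fun_eq_iff)
  with v(2) show "\<exists>x. (\<lambda>n. S (x n)) \<longlonglongrightarrow> p" by blast
next
  assume "\<exists>x. (\<lambda>n. S (x n)) \<longlonglongrightarrow> p"
  then obtain x where "(\<lambda>n. S (x n)) \<longlonglongrightarrow> p" by blast
  then show "p \<in> closure (range S)"
    unfolding closure_sequential by (intro exI[of _ "\<lambda>n. S (x n)"]) simp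
qed

text \<open>The residual r of the projection onto the closure of the range is orthogonal to S(Sr),
  so |Sr|^2 = <r, S(Sr)> = 0.\<close>

lemma positive_op_range_decomposition:
  fixes S :: "'a::complex_hilbert \<Rightarrow> 'a"
  assumes "positive_op S"
  obtains p where "p \<in> closure (range S)" "x - p \<in> nullspace S"
proof -
  have S: "bounded_clinear S" using assms by (simp add: positive_op_def)
  interpret S: bounded_linear S using S by (rule bounded_clinearD)
  have "csubspace (closure (range S))"
    unfolding csubspace_def
  proof (intro conjI ballI allI)
    have "0 \<in> range S" using S.zero by (metis rangeI)
    then show "0 \<in> closure (range S)" by (rule subsetD[OF closure_subset])
  next
    fix a b assume "a \<in> closure (range S)" "b \<in> closure (range S)"
    then obtain u v where "(\<lambda>n. S (u n)) \<longlonglongrightarrow> a" "(\<lambda>n. S (v n)) \<longlonglongrightarrow> b"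
      unfolding closure_range_iff_LIMSEQ by blast
    then have "(\<lambda>n. S (u n + v n)) \<longlonglongrightarrow> a + b" unfolding S.add by (rule tendsto_add)
    then show "a + b \<in> closure (range S)" unfolding closure_range_iff_LIMSEQ by (rule exI[of _ "\<lambda>n. u n + v n"])
  next
    fix c a assume "a \<in> closure (range S)"
    then obtain u where "(\<lambda>n. S (u n)) \<longlonglongrightarrow> a" unfolding closure_range_iff_LIMSEQ by blast
    then have "(\<lambda>n. S (c *\<^sub>C u n)) \<longlonglongrightarrow> c *\<^sub>C a"
      unfolding bounded_clinearD(2)[OF S] by (rule bounded_linear.tendsto[OF bounded_linear_scaleC])
    then show "c *\<^sub>C a \<in> closure (range S)" unfolding closure_range_iff_LIMSEQ by (rule exI[of _ "\<lambda>n. c *\<^sub>C u n"])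
  qed
  then obtain p where p: "p \<in> closure (range S)" "\<And>m. m \<in> closure (range S) \<Longrightarrow> cinner (x - p) m = 0"
    using orthogonal_decomposition[of "closure (range S)" x] by auto
  have "S (S (x - p)) \<in> closure (range S)" by (intro subsetD[OF closure_subset] rangeI)
  then have "cinner (x - p) (S (S (x - p))) = 0" by (rule p(2))
  then have "cinner (S (x - p)) (S (x - p)) = 0" by (simp add: positive_op_self_adjoint[OF assms])
  then show thesis using that p(1) by (simp add: nullspace_def)
qed

lemma orthogonal_closure_range_nullspace:
  fixes S :: "'a::complex_hilbert \<Rightarrow> 'a"
  assumes "positive_op S" "p \<in> closure (range S)" "z \<in> nullspace S"
  shows "cinner p z = 0"
proof -
  obtain u where u: "(\<lambda>n. S (u n)) \<longlonglongrightarrow> p" using assms(2) unfolding closure_range_iff_LIMSEQ by blast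
  have "cinner (S (u n)) z = 0" for n
    using assms(3) by (simp add: positive_op_self_adjoint[OF assms(1)] nullspace_def cinner.zero_right)
  moreover have "(\<lambda>n. cinner (S (u n)) z) \<longlonglongrightarrow> cinner p z" by (intro cinner.tendsto u tendsto_const)
  ultimately show ?thesis by (simp add: LIMSEQ_const_iff)
qed

text \<open>Continuity extends agreement to the closure of the range, which together with
  \<open>nullspace S\<close> spans the space.\<close>

lemma eq_if_eq_on_range_nullspace:
  fixes S F G :: "'a::complex_hilbert \<Rightarrow> 'a"
  assumes S: "positive_op S" and F: "bounded_linear F" and G: "bounded_linear G"
    and range: "\<And>x. F (S x) = G (S x)" and null: "\<And>x. x \<in> nullspace S \<Longrightarrow> F x = G x"
  shows "F = G"
proof (rule ext)
  fix x
  interpret F: bounded_linear F by fact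
  interpret G: bounded_linear G by fact
  obtain p where p: "p \<in> closure (range S)" "x - p \<in> nullspace S"
    using positive_op_range_decomposition[OF S] by blast
  obtain u where u: "(\<lambda>n. S (u n)) \<longlonglongrightarrow> p" using p(1) unfolding closure_range_iff_LIMSEQ by blast
  have "F p = G p" using F.tendsto[OF u] G.tendsto[OF u] unfolding range by (rule LIMSEQ_unique)
  then show "F x = G x" using null[OF p(2)] by (simp add: F.diff G.diff)
qed

text \<open>\<open>V\<close> is the closure of \<open>S x \<mapsto> C x\<close>, extended by zero on \<open>N(S)\<close>: its graph is \<open>R\<close> below.\<close>

lemma exists_partial_isometry_factor:
  fixes S C :: "'a::complex_hilbert \<Rightarrow> 'a"
  assumes S: "positive_op S" and C: "bounded_clinear C" and nrm: "\<And>x. norm (S x) = norm (C x)"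
  obtains V where "partial_isometry V" "nullspace V = nullspace C" "C = V \<circ> S"
proof -
  have S': "bounded_clinear S" using S by (simp add: positive_op_def)
  interpret S: bounded_linear S using S' by (rule bounded_clinearD)
  interpret C: bounded_linear C using C by (rule bounded_clinearD)
  define R where "R u w \<longleftrightarrow>
    (\<exists>p x. u - p \<in> nullspace S \<and> (\<lambda>n. S (x n)) \<longlonglongrightarrow> p \<and> (\<lambda>n. C (x n)) \<longlonglongrightarrow> w)" for u w
  have "\<exists>w. R u w" for u
  proof -
    obtain p where p: "p \<in> closure (range S)" "u - p \<in> nullspace S"
      using positive_op_range_decomposition[OF S] by blast
    then obtain x where x: "(\<lambda>n. S (x n)) \<longlonglongrightarrow> p" unfolding closure_range_iff_LIMSEQ by blast
    \<comment> \<open>Equal norms make the map from S x to C x isometric, so convergence on the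
      \<open>S\<close> side yields a Cauchy sequence on the \<open>C\<close> side.\<close>
    have "dist (C (x m)) (C (x n)) = dist (S (x m)) (S (x n))" for m n
      using nrm[of "x m - x n"] by (simp add: dist_norm S.diff C.diff)
    then have "Cauchy (\<lambda>n. C (x n))" using LIMSEQ_imp_Cauchy[OF x] by (simp add: Cauchy_def)
    then obtain w where "(\<lambda>n. C (x n)) \<longlonglongrightarrow> w" using Cauchy_convergent convergent_def by blast
    then show ?thesis using p(2) x unfolding R_def by blast
  qed
  \<comment> \<open>Only a choice of one related vector for each \<open>u\<close>; linearity follows
    once \<open>R\<close> is known to be single-valued and compatible with sums and
    multiples.\<close>
  then obtain V where V: "\<And>u. R u (V u)" by metis
  have Radd: "R (u + u') (w + w')" if "R u w" "R u' w'" for u u' w w'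
  proof -
    from that obtain p x p' x' where
      "u - p \<in> nullspace S" "(\<lambda>n. S (x n)) \<longlonglongrightarrow> p" "(\<lambda>n. C (x n)) \<longlonglongrightarrow> w"
      "u' - p' \<in> nullspace S" "(\<lambda>n. S (x' n)) \<longlonglongrightarrow> p'" "(\<lambda>n. C (x' n)) \<longlonglongrightarrow> w'"
      by (auto simp: R_def)
    then show ?thesis unfolding R_def
      by (intro exI[of _ "p + p'"] exI[of _ "\<lambda>n. x n + x' n"])
        (auto simp: S.add C.add S.diff nullspace_def intro!: tendsto_intros)
  qed
  have Rsc: "R (c *\<^sub>C u) (c *\<^sub>C w)" if "R u w" for u w c
  proof -
    from that obtain p x where px:
      "u - p \<in> nullspace S" "(\<lambda>n. S (x n)) \<longlonglongrightarrow> p" "(\<lambda>n. C (x n)) \<longlonglongrightarrow> w"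
      by (auto simp: R_def)
    have "c *\<^sub>C u - c *\<^sub>C p \<in> nullspace S"
      using px(1) by (simp add: nullspace_def S.diff bounded_clinearD(2)[OF S'])
    then show ?thesis unfolding R_def using px(2,3)
      by (intro exI[of _ "c *\<^sub>C p"] exI[of _ "\<lambda>n. c *\<^sub>C x n"])
        (auto simp: bounded_clinearD(2)[OF S'] bounded_clinearD(2)[OF C]
          intro!: bounded_linear.tendsto[OF bounded_linear_scaleC])
  qed
  \<comment> \<open>In the limit, \<open>w\<close> has the norm of the component of \<open>u\<close>
    in the closure of the range.\<close>
  have Rnorm: "\<exists>p. p \<in> closure (range S) \<and> u - p \<in> nullspace S \<and> norm w = norm p" if "R u w" for u w
  proof -
    from that obtain p x where px:
      "u - p \<in> nullspace S" "(\<lambda>n. S (x n)) \<longlonglongrightarrow> p" "(\<lambda>n. C (x n)) \<longlonglongrightarrow> w"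
      by (auto simp: R_def)
    have "norm p = norm w"
      using tendsto_norm[OF px(2)] tendsto_norm[OF px(3)] unfolding nrm by (rule LIMSEQ_unique)
    moreover have "p \<in> closure (range S)"
      using px(2) unfolding closure_range_iff_LIMSEQ by (rule exI[of _ x])
    ultimately show ?thesis using px by auto
  qed
  have pyth: "(norm u)\<^sup>2 = (norm p)\<^sup>2 + (norm (u - p))\<^sup>2"
    if "p \<in> closure (range S)" "u - p \<in> nullspace S" for u p
    using norm_add_sq[of p "u - p"] orthogonal_closure_range_nullspace[OF S that] by simp
  have Rle: "norm w \<le> norm u" if Ruw: "R u w" for u w
  proof -
    from Rnorm[OF Ruw] obtain p where p: "p \<in> closure (range S)" "u - p \<in> nullspace S" "norm w = norm p"
      by blast
    then have "(norm w)\<^sup>2 \<le> (norm u)\<^sup>2" using pyth[OF p(1,2)] by simp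
    then show ?thesis by (rule power2_le_imp_le) simp
  qed
  \<comment> \<open>By linearity of the relation, 0 is related to w - w', and \<open>Rle\<close>
    forces this difference to be 0.\<close>
  have Runique: "w = w'" if "R u w" "R u w'" for u w w'
  proof -
    have "R (u + (- 1) *\<^sub>C u) (w + (- 1) *\<^sub>C w')" by (intro Radd Rsc that)
    then have "norm (w + (- 1) *\<^sub>C w') \<le> norm (u + (- 1) *\<^sub>C u)" by (rule Rle)
    moreover have "(- 1) *\<^sub>C v = - v" for v :: 'a using scaleC_of_real[of "- 1" v] by simp
    ultimately show ?thesis by simp
  qed
  have V_eq: "V u = w" if "R u w" for u w using V that by (rule Runique)
  have RS: "R (S x) (C x)" for x
    unfolding R_def by (intro exI[of _ "S x"] exI[of _ "\<lambda>_. x"]) (simp add: nullspace_def S.zero)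
  have "bounded_linear V"
  proof (rule bounded_linear_intro[where K = 1])
    show "V (x + y) = V x + V y" for x y by (intro V_eq Radd V)
    show "V (r *\<^sub>R x) = r *\<^sub>R V x" for r x
      using V_eq[OF Rsc[OF V, of "of_real r"]] by (simp add: scaleC_of_real)
    show "norm (V x) \<le> norm x * 1" for x using Rle[OF V] by simp
  qed
  then have bV: "bounded_clinear V" by (auto simp: bounded_clinear_def intro: V_eq Rsc V)
  have SC: "nullspace S = nullspace C"
    unfolding nullspace_def using nrm by (metis norm_eq_zero)
  have NV: "nullspace V = nullspace C"
  proof (intro equalityI subsetI)
    fix u assume "u \<in> nullspace V"
    with Rnorm[OF V[of u]] show "u \<in> nullspace C" unfolding SC[symmetric] by (auto simp: nullspace_def)
  next
    fix u assume u: "u \<in> nullspace C"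
    have "R u 0" unfolding R_def using u
      by (intro exI[of _ 0] exI[of _ "\<lambda>_. 0"]) (simp add: SC S.zero C.zero)
    then show "u \<in> nullspace V" by (simp add: V_eq nullspace_def)
  qed
  have "norm (V u) = norm u" if orth: "\<forall>z\<in>nullspace V. cinner u z = 0" for u
  proof -
    obtain p where p: "p \<in> closure (range S)" "u - p \<in> nullspace S" "norm (V u) = norm p"
      using Rnorm[OF V] by blast
    \<comment> \<open>Both \<open>u\<close> and \<open>p\<close> are orthogonal to the null
      component u - p, so it is orthogonal to itself and u = p.\<close>
    have "cinner u (u - p) = 0" using orth p(2) by (simp add: NV SC)
    moreover have "cinner p (u - p) = 0" by (rule orthogonal_closure_range_nullspace[OF S p(1,2)])
    ultimately have "cinner (u - p) (u - p) = 0" by (simp only: cinner.diff_left[of u p]) simp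
    then show ?thesis using p(3) by simp
  qed
  then have "partial_isometry V" using bV by (auto simp: partial_isometry_def)
  moreover have "C = V \<circ> S" using V_eq[OF RS] by auto
  ultimately show thesis using that NV by blast
qed

text \<open>Two candidates agree on the range of \<open>abs_op C\<close>, where both are determined
  by \<open>C\<close>, and both vanish on its nullspace, which is that of \<open>C\<close>. Hence
  the definite description is resolved.\<close>

lemma isometric_part:
  fixes C :: "'a::complex_hilbert \<Rightarrow> 'a"
  assumes C: "bounded_clinear C"
  shows "partial_isometry (isometric_part C)" "nullspace (isometric_part C) = nullspace C"
    "C = isometric_part C \<circ> abs_op C"
proof -
  let ?P = "\<lambda>V. partial_isometry V \<and> nullspace V = nullspace C \<and> C = V \<circ> abs_op C"
  obtain V where V: "?P V"
    using exists_partial_isometry_factor[OF abs_op(1)[OF C] C norm_abs_op[OF C]] by blast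
  have "V' = V" if V': "?P V'" for V'
  proof (rule eq_if_eq_on_range_nullspace[OF abs_op(1)[OF C]])
    show "bounded_linear V'" "bounded_linear V"
      using V V' by (auto simp: partial_isometry_def bounded_clinear_def)
    show "V' (abs_op C x) = V (abs_op C x)" for x using V V' by (metis comp_apply)
    show "V' x = V x" if "x \<in> nullspace (abs_op C)" for x
    proof -
      have "x \<in> nullspace C" using that norm_abs_op[OF C, of x] by (simp add: nullspace_def)
      then have "x \<in> nullspace V'" "x \<in> nullspace V" using V V' by auto
      then show ?thesis by (simp add: nullspace_def)
    qed
  qed
  with V have "\<exists>!V. ?P V" by blast
  then have "?P (isometric_part C)" unfolding isometric_part_def by (rule theI')
  then show "partial_isometry (isometric_part C)" "nullspace (isometric_part C) = nullspace C"
    "C = isometric_part C \<circ> abs_op C" by auto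
qed

section \<open>Products of projections\<close>

text \<open>The adjoint of PQ is QP, and idempotence reduces PQ QP PQ to PQ PQ.\<close>

lemma projection_product_identity:
  fixes T :: "'a::complex_hilbert \<Rightarrow> 'a"
  assumes "T \<in> \<XX>"
  shows "bounded_clinear T" "T (cadjoint T (T x)) = T (T x)"
proof -
  obtain P Q where T: "T = P \<circ> Q" and P: "orthogonal_projection P" and Q: "orthogonal_projection Q"
    using assms by (auto simp: projection_products_def)
  have bP: "bounded_clinear P" "cadjoint P = P" and bQ: "bounded_clinear Q" "cadjoint Q = Q"
    using P Q by (auto simp: orthogonal_projection_def)
  have PP: "P (P x) = P x" and QQ: "Q (Q x) = Q x" for x
    using P Q by (simp_all add: orthogonal_projection_def numeral_2_eq_2 fun_eq_iff)
  show "bounded_clinear T" unfolding T by (intro bounded_clinear_compose bP bQ)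
  have "cadjoint T = Q \<circ> P"
  proof (rule cadjoint_eqI)
    show "bounded_clinear (Q \<circ> P)" by (intro bounded_clinear_compose bP bQ)
    show "cinner (T x) y = cinner x ((Q \<circ> P) y)" for x y
      using cadjoint(2)[OF bP(1)] cadjoint(2)[OF bQ(1)] by (simp add: T bP(2) bQ(2))
  qed
  then show "T (cadjoint T (T x)) = T (T x)" by (simp add: T PP QQ)
qed

lemma isometric_part_square:
  fixes T :: "'a::complex_hilbert \<Rightarrow> 'a"
  assumes "T \<in> \<XX>"
  shows "isometric_part T ^^ 2 = T"
proof -
  note T = projection_product_identity[OF assms]
  define V S where "V = isometric_part T" and "S = abs_op T"
  have S: "positive_op S" "\<And>x. S (S x) = cadjoint T (T x)"
    using abs_op[OF T(1)] by (simp_all add: S_def fun_eq_iff)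
  have nS: "norm (S x) = norm (T x)" for x unfolding S_def by (rule norm_abs_op[OF T(1)])
  have V: "partial_isometry V" "nullspace V = nullspace T"
    unfolding V_def by (rule isometric_part[OF T(1)])+
  have TVS: "T x = V (S x)" for x
    using fun_cong[OF isometric_part(3)[OF T(1)], of x] by (simp add: V_def S_def)
  interpret T: bounded_linear T using T(1) by (rule bounded_clinearD)
  interpret V: bounded_linear V using V(1) by (simp add: partial_isometry_def bounded_clinear_def)
  interpret S: bounded_linear S using S(1) by (simp add: positive_op_def bounded_clinear_def)
  have NS: "nullspace S = nullspace T" unfolding nullspace_def using nS by (metis norm_eq_zero)
  have "(\<lambda>x. S (V x)) = (\<lambda>x. S (S x))"
  proof (rule eq_if_eq_on_range_nullspace[OF S(1)])
    show "bounded_linear (\<lambda>x. S (V x))" "bounded_linear (\<lambda>x. S (S x))"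
      by (rule bounded_linear_compose[OF S.bounded_linear_axioms], rule V.bounded_linear_axioms S.bounded_linear_axioms)+
    show "S (V (S x)) = S (S (S x))" for x
    proof -
      have "T (T x - S (S x)) = 0" by (simp add: T.diff S(2) T(2))
      \<comment> \<open>\<open>S\<close> and \<open>T\<close> have equal norms at every vector, so a
        zero of \<open>T\<close> is a zero of \<open>S\<close>.\<close>
      then have "S (T x - S (S x)) = 0" using nS by (metis norm_eq_zero)
      then show ?thesis by (simp add: S.diff flip: TVS)
    qed
    show "S (V x) = S (S x)" if "x \<in> nullspace S" for x
    proof -
      have "x \<in> nullspace V" using that by (simp add: NS V(2))
      then show ?thesis using that by (simp add: nullspace_def)
    qed
  qed
  then have "S (V x - S x) = 0" for x by (simp add: S.diff fun_eq_iff)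
  then have "V x - S x \<in> nullspace V" for x using NS V(2) by (auto simp: nullspace_def)
  then have "V (V x) = T x" for x by (simp add: TVS V.diff nullspace_def)
  then show ?thesis by (auto simp: V_def numeral_2_eq_2)
qed

theorem corollary5p3:
  shows "bij_betw (\<lambda>V. V ^^ 2) (\<J>\<^sub>\<XX> :: ('a::complex_hilbert \<Rightarrow> 'a) set) \<XX>
    \<and> (\<XX> :: ('a \<Rightarrow> 'a) set) = {V ^^ 2 | V. V \<in> \<J>\<^sub>\<XX>}"
proof -
  have "bij_betw (\<lambda>V. V ^^ 2) (\<J>\<^sub>\<XX> :: ('a \<Rightarrow> 'a) set) \<XX>"
    \<comment> \<open>For V the isometric part of T, squaring returns T, whose isometric part is V
      again; so both composites are identities.\<close>
    by (rule bij_betwI[where g = isometric_part])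
      (auto simp: isometric_parts_def isometric_part_square)
  then show ?thesis unfolding bij_betw_def by blast
qed

end
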